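(* Let $G$ be a non-trivial separable locally compact abelian topological group. Then $G$ is $d$-independent if and only if $G$ is an $M$-group.
   Context: All topological groups are Hausdorff. $\mathfrak c=|\mathbb R|$. Separable means having a countable dense subset. A non-trivial topological group $G$ is called $d$-independent if for every subgroup $S\le G$ with $|S|<\mathfrak c$ there exists a countable dense subgroup $D$ of $G$ such that $S\cap D$ is the trivial subgroup. An abelian group $G$ (written additively) is called an $M$-group if for every integer $n$, the cardinality of $nG=\{ng:g\in G\}$ is either $1$ or at least $\mathfrak c$. *)

theory Defs
  imports "HOL-Analysis.Analysis"
begin

definition add_subgroup :: "'a::group_add set \<Rightarrow> bool" where
  "add_subgroup S \<longleftrightarrow> 0 \<in> S \<and> (\<forall>x\<in>S. \<forall>y\<in>S. x + y \<in> S) \<and> (\<forall>x\<in>S. - x \<in> S)"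

(* The topological group is the whole type; its cardinal comparisons with the continuum
   are comparisons with UNIV :: real set.  Groups here need not be commutative, although
   they are written additively. *)
definition d_independent :: "'a::{topological_group_add, t2_space} itself \<Rightarrow> bool" where
  "d_independent _ \<longleftrightarrow>
     (\<exists>x::'a. x \<noteq> 0) \<and>
     (\<forall>S::'a set. add_subgroup S \<and> S \<prec> (UNIV :: real set) \<longrightarrow>
        (\<exists>D. add_subgroup D \<and> countable D \<and> closure D = UNIV \<and> S \<inter> D = {0}))"

definition int_multiple :: "int \<Rightarrow> 'a::ab_group_add \<Rightarrow> 'a" where
  "int_multiple n g =
     (if n \<ge> 0 then iterate_add (nat n) g else - iterate_add (nat (- n)) g)"

(* card of an infinite set is 0, so card = 1 does mean "exactly one element". *)
definition M_group :: "'a::ab_group_add itself \<Rightarrow> bool" where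
  "M_group _ \<longleftrightarrow>
     (\<forall>n::int. card (range (int_multiple n :: 'a \<Rightarrow> 'a)) = 1 \<or>
               (UNIV :: real set) \<lesssim> range (int_multiple n :: 'a \<Rightarrow> 'a))"

end

(* If 1 < |nG| < c, a dense subgroup D missing the subgroup S = nG satisfies nD = 0, hence nG = 0
   by density.

   Conversely, in a separable M-group every kernel G[n] with nG nonzero has empty interior, for
   otherwise it would be open and nG countable.  This gives shrinking neighbourhoods V_n of 0 with
   compact closure and elements a_n in V_n such that the subset sums of (a_n) form a Cantor tree:
   two of them that first split at place j >= |k| differ by an element x with k x outside the
   subgroup N, the intersection of the V_n.  Hence, given T of cardinality < c, fewer than c
   branches hit T + N under some multiplication k with kG nonzero, and every V_n contains an x that
   avoids T + N under all of them.

   Choose such x_i in V_i one after another, avoiding S + E_i + N, where E_i is generated by a dense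
   sequence (d_j) and the earlier x's.  Distribute the x_i into infinitely many subsequences, one
   for each j.  Since G need not be metrizable they need not converge to 0, but the j-th one
   accumulates at some y_j in N, so the elements d_j - y_j + x_i generate a dense subgroup D.  In an
   element of S on these generators, the last generator with a coefficient k such that kG is nonzero
   would place k x_i in S + E_i + N; so S meets D trivially. *)

theory Submission
  imports Defs
begin

section \<open>Abelian groups as modules over the integers\<close>

text \<open>Makes the module library available for subgroups: subspaces are then the subgroups, and
  spans the generated subgroups.\<close>

interpretation intmod: module "int_multiple :: int \<Rightarrow> 'a::ab_group_add \<Rightarrow> 'a"
proof
  have minus: "int_multiple (- a) x = - int_multiple a x" for a and x :: 'a
    by (auto simp: int_multiple_def)
  have add_nat: "int_multiple (int m + int n) x = int_multiple (int m) x + int_multiple (int n) x"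
    for m n and x :: 'a
    by (simp add: int_multiple_def nat_add_distrib)
  have diff_nat: "int_multiple (int m - int n) x = int_multiple (int m) x - int_multiple (int n) x"
    for m n and x :: 'a
  proof (cases "n \<le> m")
    case True
    then show ?thesis using add_nat[of "m - n" n x] by (simp add: of_nat_diff algebra_simps)
  next
    case False
    then show ?thesis using add_nat[of "n - m" m x] minus[of "int m - int n" x]
      by (simp add: of_nat_diff algebra_simps)
  qed
  fix a b :: int and x y :: 'a
  show left_distrib: "int_multiple (a + b) x = int_multiple a x + int_multiple b x" for a b and x :: 'a
  proof -
    \<comment> \<open>Writing both integers as differences of naturals removes the sign cases of
      \<open>int_multiple\<close>.\<close>
    obtain p q where a: "a = int p - int q" by (metis diff_zero int_cases2 of_nat_0 diff_0)
    obtain r s where b: "b = int r - int s" by (metis diff_zero int_cases2 of_nat_0 diff_0)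
    have "a + b = int (p + r) - int (q + s)" using a b by simp
    then have "int_multiple (a + b) x = int_multiple (int (p + r)) x - int_multiple (int (q + s)) x"
      by (simp only: diff_nat)
    then show ?thesis by (simp add: a b diff_nat add_nat algebra_simps)
  qed
  have one: "int_multiple 1 x = x" for x :: 'a
    by (simp add: int_multiple_def)
  then show "int_multiple 1 x = x" .
  have zero: "int_multiple 0 x = 0" for x :: 'a
    by (simp add: int_multiple_def)
  have diff1: "int_multiple (a - 1) x = int_multiple a x - x" for a and x :: 'a
    using left_distrib[of "a - 1" 1 x] one[of x] by (simp add: algebra_simps)
  show "int_multiple a (x + y) = int_multiple a x + int_multiple a y"
    by (induction a rule: int_induct[where k = 0]) (simp_all add: zero one left_distrib diff1)
  have left_diff: "int_multiple (a - b) x = int_multiple a x - int_multiple b x" for a b and x :: 'a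
    using left_distrib[of "a - b" b x] by (simp add: algebra_simps)
  show "int_multiple a (int_multiple b x) = int_multiple (a * b) x"
    by (induction a rule: int_induct[where k = 0])
      (simp_all add: zero one left_distrib left_diff diff1 algebra_simps)
qed

lemma subspace_iff_add_subgroup: "intmod.subspace S \<longleftrightarrow> add_subgroup S"
proof
  assume "intmod.subspace S"
  then show "add_subgroup S"
    by (auto simp: add_subgroup_def intmod.subspace_0 intmod.subspace_add intmod.subspace_neg)
next
  assume S: "add_subgroup S"
  have diff: "x - y \<in> S" if "x \<in> S" "y \<in> S" for x y
    using S that by (metis add_subgroup_def diff_conv_add_uminus)
  have "int_multiple c x \<in> S" if "x \<in> S" for c x
    by (induction c rule: int_induct[where k = 0])
      (use S that diff in \<open>auto simp: add_subgroup_def intmod.scale_left_distrib intmod.scale_left_diff_distrib\<close>)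
  then show "intmod.subspace S"
    using S by (auto simp: add_subgroup_def intmod.subspace_def)
qed

lemma intmod_subspace_sums:
  assumes "intmod.subspace A" "intmod.subspace B"
  shows "intmod.subspace {a + b |a b. a \<in> A \<and> b \<in> B}"
proof -
  have "{a + b |a b. a \<in> A \<and> b \<in> B} = intmod.span (A \<union> B)"
    unfolding intmod.span_Un intmod.span_eq_iff[THEN iffD2, OF assms(1)]
      intmod.span_eq_iff[THEN iffD2, OF assms(2)] by blast
  then show ?thesis by simp
qed

lemma tendsto_int_multiple [tendsto_intros]:
  fixes f :: "'b \<Rightarrow> 'a::topological_ab_group_add"
  assumes "(f \<longlongrightarrow> l) F"
  shows "((\<lambda>x. int_multiple n (f x)) \<longlongrightarrow> int_multiple n l) F"
proof -
  have "((\<lambda>x. iterate_add m (f x)) \<longlongrightarrow> iterate_add m l) F" for m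
    by (induction m) (auto intro!: tendsto_intros assms)
  then show ?thesis
    by (auto simp: int_multiple_def intro!: tendsto_intros)
qed

section \<open>Cardinals below the continuum\<close>

lemma lepoll_or_lesspoll: "A \<lesssim> B \<or> B \<prec> A"
proof -
  have "A \<lesssim> B \<or> B \<lesssim> A"
    unfolding lepoll_def card_of_ordLeq
    by (intro ordLeq_total card_of_Well_order)
  then show ?thesis
    unfolding lesspoll_def using eqpoll_imp_lepoll eqpoll_sym by blast
qed

text \<open>A real is determined by the set of rationals below it, and \<open>from_nat\<close> codes
  rationals by naturals.\<close>

lemma UNIV_real_lepoll_nat_set: "(UNIV :: real set) \<lesssim> (UNIV :: nat set set)"
proof -
  have "inj (\<lambda>x. {n. of_rat (from_nat n) < (x::real)})"
  proof (rule linorder_injI)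
    fix x y :: real
    assume "x < y"
    then obtain q where "x < of_rat q" "of_rat q < y"
      using of_rat_dense by blast
    then have "to_nat q \<in> {n. of_rat (from_nat n) < y} - {n. of_rat (from_nat n) < x}"
      by simp
    then show "{n. of_rat (from_nat n) < x} \<noteq> {n. of_rat (from_nat n) < y}"
      by blast
  qed
  then show ?thesis
    by (auto simp: lepoll_def)
qed

text \<open>An infinite \<open>A\<close> absorbs the factor, as \<open>C\<close> embeds in
  \<open>A\<close> and \<open>A \<times> A\<close> in \<open>A\<close>; for finite \<open>A\<close>
  the product is countable.\<close>

lemma lesspoll_real_times_countable:
  assumes "A \<prec> (UNIV :: real set)" "countable C"
  shows "A \<times> C \<prec> (UNIV :: real set)"
proof (cases "finite A")
  case True
  then have "countable (A \<times> C)"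
    using assms by (simp add: countable_finite)
  then have "\<not> (UNIV :: real set) \<lesssim> A \<times> C"
    using countable_lepoll uncountable_UNIV_real by blast
  then show ?thesis
    using lepoll_or_lesspoll by blast
next
  case False
  have "C \<lesssim> A"
  proof (rule lepoll_trans)
    show "C \<lesssim> (UNIV :: nat set)"
      using assms(2) by (auto simp: countable_def lepoll_def)
    show "(UNIV :: nat set) \<lesssim> A"
      using False by (simp add: infinite_le_lepoll)
  qed
  then have "A \<times> C \<lesssim> A \<times> A"
    by (intro times_lepoll_mono) auto
  also have "A \<times> A \<lesssim> A"
    unfolding lepoll_def card_of_ordLeq
    using card_of_Times_same_infinite[OF False] ordIso_iff_ordLeq by blast
  also note assms(1)
  finally show ?thesis .
qed

text \<open>Every element is coded by a finite list of pairs of a coefficient and a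
  generator.\<close>

lemma countable_span:
  assumes "countable A"
  shows "countable (intmod.span A)"
proof -
  have "intmod.span A \<subseteq> (\<lambda>xs. \<Sum>(k, a)\<leftarrow>xs. int_multiple k a) ` lists (UNIV \<times> A)"
  proof
    fix x assume "x \<in> intmod.span A"
    then show "x \<in> (\<lambda>xs. \<Sum>(k, a)\<leftarrow>xs. int_multiple k a) ` lists (UNIV \<times> A)"
    proof (induction rule: intmod.span_induct_alt)
      case base
      show ?case by (rule image_eqI[of _ _ "[]"]) auto
    next
      case (step c x y)
      then obtain xs where "xs \<in> lists (UNIV \<times> A)" "y = (\<Sum>(k, a)\<leftarrow>xs. int_multiple k a)"
        by blast
      with step.hyps show ?case
        by (intro image_eqI[of _ _ "(c, x) # xs"]) auto
    qed
  qed
  then show ?thesis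
    using assms by (meson countable_SIGMA countable_image countable_lists countable_subset
      countableI_type)
qed

section \<open>Accumulation points and neighbourhoods\<close>

text \<open>Gives a cluster point only: without first countability a sequence in a compact set need
  not have a convergent subsequence.\<close>

lemma compact_accumulation:
  assumes "compact C" "\<And>n::nat. f n \<in> C"
  shows "\<exists>y\<in>C. \<forall>U m. open U \<and> y \<in> U \<longrightarrow> (\<exists>n\<ge>m. f n \<in> U)"
proof -
  have "\<exists>y\<in>C. inf (nhds y) (filtermap f sequentially) \<noteq> bot"
    using assms compact_filter[of C]
    by (auto simp: filtermap_bot_iff eventually_filtermap)
  then obtain y where y: "y \<in> C" "inf (nhds y) (filtermap f sequentially) \<noteq> bot"
    by blast
  have "\<exists>n\<ge>m. f n \<in> U" if "open U" "y \<in> U" for U m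
  proof (rule ccontr)
    assume "\<not> (\<exists>n\<ge>m. f n \<in> U)"
    then have "eventually (\<lambda>z. z \<notin> U) (filtermap f sequentially)"
      by (auto simp: eventually_filtermap eventually_sequentially)
    moreover have "eventually (\<lambda>z. z \<in> U) (nhds y)"
      using that by (rule eventually_nhds_in_open)
    ultimately have "eventually (\<lambda>_. False) (inf (nhds y) (filtermap f sequentially))"
      unfolding eventually_inf by blast
    with y show False
      by (simp add: trivial_limit_def)
  qed
  with y show ?thesis by blast
qed

text \<open>Lets one neighbourhood serve all three variables when group operations are controlled
  near a point.\<close>

lemma nhds_cube:
  fixes P :: "'a::topological_space \<Rightarrow> 'a \<Rightarrow> 'a \<Rightarrow> bool"
  assumes "eventually (\<lambda>(x, y, z). P x y z) (nhds (a, a, a))"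
  obtains W where "open W" "a \<in> W" "\<And>x y z. x \<in> W \<Longrightarrow> y \<in> W \<Longrightarrow> z \<in> W \<Longrightarrow> P x y z"
proof -
  obtain S where S: "open S" "(a, a, a) \<in> S" "\<And>x y z. (x, y, z) \<in> S \<Longrightarrow> P x y z"
    using assms unfolding eventually_nhds by fast
  obtain A B where AB: "open A" "open B" "(a, a, a) \<in> A \<times> B" "A \<times> B \<subseteq> S"
    using S open_prod_elim by metis
  obtain B1 B2 where B: "open B1" "open B2" "(a, a) \<in> B1 \<times> B2" "B1 \<times> B2 \<subseteq> B"
    using AB open_prod_elim[of B "(a, a)"] by (metis mem_Sigma_iff)
  show thesis
  proof (rule that[of "A \<inter> (B1 \<inter> B2)"])
    show "open (A \<inter> (B1 \<inter> B2))" using AB B by (intro open_Int)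
    show "a \<in> A \<inter> (B1 \<inter> B2)" using AB B by blast
    show "P x y z" if "x \<in> A \<inter> (B1 \<inter> B2)" "y \<in> A \<inter> (B1 \<inter> B2)" "z \<in> A \<inter> (B1 \<inter> B2)" for x y z
      using that AB B by (intro S) blast
  qed
qed

section \<open>Kernels of integer multiplications\<close>

lemma continuous_on_int_multiple: "continuous_on A (int_multiple n :: 'a::topological_ab_group_add \<Rightarrow> 'a)"
  unfolding continuous_on by (auto intro!: tendsto_intros)

lemma open_int_multiple_nonzero:
  "open {x :: 'a::{topological_ab_group_add, t2_space}. int_multiple n x \<noteq> 0}"
  by (intro open_Collect_neq continuous_on_int_multiple continuous_on_const)

text \<open>
  A kernel of multiplication by \<open>n\<close> with interior points would be open, so each of its cosets
  would meet \<open>E\<close>.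
\<close>

lemma int_multiple_nonzero_in_open:
  fixes U :: "'a::topological_ab_group_add set"
  assumes dense: "countable E" "closure E = (UNIV :: 'a set)"
    and unc: "uncountable (range (int_multiple n :: 'a \<Rightarrow> 'a))"
    and U: "open U" "U \<noteq> {}"
  shows "\<exists>x\<in>U. int_multiple n x \<noteq> 0"
proof (rule ccontr)
  assume zero: "\<not> (\<exists>x\<in>U. int_multiple n x \<noteq> 0)"
  obtain u where u: "u \<in> U" using U by blast
  have "int_multiple n g \<in> int_multiple n ` E" for g :: 'a
  proof -
    \<comment> \<open>Translation by \<open>u - g\<close> carries \<open>g\<close> into
      \<open>U\<close>, hence also some nearby \<open>d\<close> from the dense set; then
      \<open>d\<close> and \<open>g\<close> have the same multiple.\<close>
    have "((\<lambda>d. d - g + u) \<longlongrightarrow> g - g + u) (nhds g)"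
      by (intro tendsto_intros filterlim_ident)
    then have "eventually (\<lambda>d. d - g + u \<in> U) (nhds g)"
      using U u by (auto dest: topological_tendstoD)
    then obtain T where T: "open T" "g \<in> T" "\<And>d. d \<in> T \<Longrightarrow> d - g + u \<in> U"
      unfolding eventually_nhds by blast
    then obtain d where d: "d \<in> E" "d \<in> T"
      using dense(2) closure_iff_nhds_not_empty[of g E] by (metis UNIV_I disjoint_iff order_refl)
    then have "int_multiple n (d - g + u) = 0" "int_multiple n u = 0"
      using T zero u by auto
    then have "int_multiple n g = int_multiple n d"
      by (simp add: intmod.scale_right_distrib intmod.scale_right_diff_distrib)
    then show ?thesis using d by blast
  qed
  then have "range (int_multiple n :: 'a \<Rightarrow> 'a) \<subseteq> int_multiple n ` E" by blast
  then show False
    using unc dense(1) countable_subset by blast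
qed

text \<open>The complements of the kernels are open, so \<open>U\<close> can be cut down by them one
  at a time and stays nonempty.\<close>

lemma int_multiples_nonzero_in_open:
  fixes U :: "'a::{topological_ab_group_add, t2_space} set"
  assumes dense: "countable E" "closure E = (UNIV :: 'a set)"
    and "finite F" "\<And>n. n \<in> F \<Longrightarrow> uncountable (range (int_multiple n :: 'a \<Rightarrow> 'a))"
    and "open U" "U \<noteq> {}"
  shows "\<exists>x\<in>U. \<forall>n\<in>F. int_multiple n x \<noteq> 0"
  using assms(3-6)
proof (induction F arbitrary: U rule: finite_induct)
  case empty
  then show ?case by blast
next
  case (insert n F)
  let ?V = "U \<inter> {x. int_multiple n x \<noteq> 0}"
  have "open ?V"
    using insert.prems open_int_multiple_nonzero by blast
  moreover have "?V \<noteq> {}"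
    using int_multiple_nonzero_in_open[OF dense, of n U] insert.prems by blast
  ultimately have "\<exists>x\<in>?V. \<forall>n\<in>F. int_multiple n x \<noteq> 0"
    using insert.IH[of ?V] insert.prems(1) by blast
  then show ?case by auto
qed

section \<open>Construction of the branching sequence\<close>

text \<open>
  Tails of the series of the \<open>a i\<close> accumulate only in the closure of \<open>V (Suc n)\<close>, which is
  covered by \<open>V (Suc n) - V (Suc n)\<close>; hence the differences in \<open>separated\<close>.
\<close>

locale branching_sequence =
  fixes V :: "nat \<Rightarrow> 'a::topological_ab_group_add set" and a :: "nat \<Rightarrow> 'a" and C :: "'a set"
  assumes compact: "compact C"
    and V_sub: "V n \<subseteq> C"
    and V_open: "open (V n)"
    and V_zero: "0 \<in> V n"
    and V_diff: "x \<in> V (Suc n) \<Longrightarrow> y \<in> V (Suc n) \<Longrightarrow> x - y \<in> V n"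
    and V_shift: "x \<in> V (Suc n) \<Longrightarrow> a n + x \<in> V n"
    and separated: "\<bar>k\<bar> \<le> int n \<Longrightarrow> int_multiple k (g :: 'a) \<noteq> 0 \<Longrightarrow> {x, x', y, y'} \<subseteq> V (Suc n) \<Longrightarrow>
      int_multiple k (a n + (x - x') - (y - y')) \<notin> V (Suc n)"

text \<open>Dependent choice on the neighbourhoods. Stage \<open>j\<close> has only finitely many
  multipliers to handle, so one \<open>a\<close> in \<open>V\<close> is killed by none of them, and
  by continuity this survives small perturbations of \<open>a\<close>.\<close>

lemma branching_sequence_exists:
  fixes C :: "'a::{topological_ab_group_add, t2_space} set"
  assumes dense: "countable E" "closure E = (UNIV :: 'a set)"
    and unc: "\<And>n. (\<exists>g::'a. int_multiple n g \<noteq> 0) \<Longrightarrow> uncountable (range (int_multiple n :: 'a \<Rightarrow> 'a))"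
    and C: "compact C" "open U" "0 \<in> U" "U \<subseteq> C"
  shows "\<exists>V a. branching_sequence V a C"
proof -
  define K where "K j = {n. \<bar>n\<bar> \<le> int j \<and> (\<exists>g::'a. int_multiple n g \<noteq> 0)}" for j
  have fin: "finite (K j)" for j
    by (rule finite_subset[of _ "{- int j..int j}"]) (auto simp: K_def)
  define P where "P V = (open V \<and> (0::'a) \<in> V \<and> V \<subseteq> C)" for V
  define Q where "Q j V W a = ((\<forall>x\<in>W. \<forall>y\<in>W. x - y \<in> V) \<and> (\<forall>x\<in>W. a + x \<in> V) \<and>
    (\<forall>k\<in>K j. \<forall>x\<in>W. \<forall>x'\<in>W. \<forall>y\<in>W. \<forall>y'\<in>W. int_multiple k (a + (x - x') - (y - y')) \<notin> W))" for j V W and a :: 'a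
  have "\<exists>V. \<forall>n. P (V n) \<and> (\<exists>a. Q n (V n) (V (Suc n)) a)"
  proof (rule dependent_nat_choice)
    show "\<exists>V. P V" using C by (auto simp: P_def)
  next
    fix V j assume V: "P V"
    have "\<exists>a\<in>V. \<forall>n\<in>K j. int_multiple n a \<noteq> 0"
      by (rule int_multiples_nonzero_in_open[OF dense fin])
        (use V unc in \<open>auto simp: P_def K_def\<close>)
    then obtain a where a: "a \<in> V" "\<And>n. n \<in> K j \<Longrightarrow> int_multiple n a \<noteq> 0" by blast
    have fst: "((\<lambda>p::'a \<times> 'a \<times> 'a. fst p) \<longlongrightarrow> 0) (nhds (0, 0, 0))"
      and snd: "((\<lambda>p::'a \<times> 'a \<times> 'a. fst (snd p)) \<longlongrightarrow> 0) (nhds (0, 0, 0))"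
      and trd: "((\<lambda>p::'a \<times> 'a \<times> 'a. snd (snd p)) \<longlongrightarrow> 0) (nhds (0, 0, 0))"
      using tendsto_fst[OF filterlim_ident[of "nhds (0, 0, 0)"]]
        tendsto_fst[OF tendsto_snd[OF filterlim_ident[of "nhds (0, 0, 0)"]]]
        tendsto_snd[OF tendsto_snd[OF filterlim_ident[of "nhds (0, 0, 0)"]]] by simp_all
    have diff: "((\<lambda>p::'a \<times> 'a \<times> 'a. fst p - fst (snd p)) \<longlongrightarrow> 0 - 0) (nhds (0, 0, 0))"
      by (intro tendsto_intros fst snd)
    from diff have 1: "eventually (\<lambda>p::'a \<times> 'a \<times> 'a. fst p - fst (snd p) \<in> V) (nhds (0, 0, 0))"
      using V by (auto simp: P_def dest: topological_tendstoD)
    have "((\<lambda>p::'a \<times> 'a \<times> 'a. a + fst p) \<longlongrightarrow> a + 0) (nhds (0, 0, 0))"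
      by (intro tendsto_intros fst)
    then have 2: "eventually (\<lambda>p::'a \<times> 'a \<times> 'a. a + fst p \<in> V) (nhds (0, 0, 0))"
      using V a by (auto simp: P_def dest: topological_tendstoD)
    \<comment> \<open>The third coordinate stands for an arbitrary element of the next
      neighbourhood, which the perturbed multiples of \<open>a\<close> must miss.\<close>
    have 3: "eventually (\<lambda>p::'a \<times> 'a \<times> 'a.
        int_multiple k (a + fst p - fst (snd p)) - snd (snd p) \<in> - {0}) (nhds (0, 0, 0))"
      if "k \<in> K j" for k
    proof (rule topological_tendstoD)
      show "((\<lambda>p::'a \<times> 'a \<times> 'a. int_multiple k (a + fst p - fst (snd p)) - snd (snd p)) \<longlongrightarrow>
          int_multiple k (a + 0 - 0) - 0) (nhds (0, 0, 0))"
        by (intro tendsto_intros fst snd trd)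
    qed (use a that in auto)
    have "eventually (\<lambda>p. \<forall>k\<in>K j.
        int_multiple k (a + fst p - fst (snd p)) - snd (snd p) \<in> - {0}) (nhds (0, 0, 0))"
      by (intro eventually_ball_finite fin ballI 3)
    then have "eventually (\<lambda>(x, y, z). x - y \<in> V \<and> a + x \<in> V \<and>
        (\<forall>k\<in>K j. int_multiple k (a + x - y) \<noteq> z)) (nhds (0, 0, 0))"
      using 1 2 by eventually_elim auto
    then obtain W where W: "open W" "0 \<in> W" "\<And>x y z. x \<in> W \<Longrightarrow> y \<in> W \<Longrightarrow> z \<in> W \<Longrightarrow>
        x - y \<in> V \<and> a + x \<in> V \<and> (\<forall>k\<in>K j. int_multiple k (a + x - y) \<noteq> z)"
      by (rule nhds_cube) (rule that; assumption)
    \<comment> \<open>A second shrinking: differences of elements of \<open>W'\<close> lie in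
      \<open>W\<close>, so the two differences required by \<open>separated\<close> can be fed to
      the property of \<open>W\<close>.\<close>
    from diff have "eventually (\<lambda>p::'a \<times> 'a \<times> 'a. fst p - fst (snd p) \<in> W) (nhds (0, 0, 0))"
      using W by (auto dest: topological_tendstoD)
    then have "eventually (\<lambda>(x, y, z::'a). x - y \<in> W) (nhds (0, 0, 0))"
      by eventually_elim auto
    then obtain W' where W': "open W'" "0 \<in> W'" "\<And>x y z::'a. x \<in> W' \<Longrightarrow> y \<in> W' \<Longrightarrow> z \<in> W' \<Longrightarrow> x - y \<in> W"
      by (rule nhds_cube) (rule that; assumption)
    have sub: "W' \<subseteq> W" "W \<subseteq> V"
      using W'(3)[of _ 0 0] W'(2) W(3)[of _ 0 0] W(2) by auto
    then have "P W'" using V W' by (auto simp: P_def)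
    moreover have "Q j V W' a"
      unfolding Q_def
    proof (intro conjI ballI)
      show "x - y \<in> V" if "x \<in> W'" "y \<in> W'" for x y
        using W(3)[of x y y] sub that by blast
      show "a + x \<in> V" if "x \<in> W'" for x
        using W(3)[of x x x] sub that by blast
      show "int_multiple k (a + (x - x') - (y - y')) \<notin> W'"
        if "k \<in> K j" "x \<in> W'" "x' \<in> W'" "y \<in> W'" "y' \<in> W'" for k x x' y y'
        using W(3)[of "x - x'" "y - y'"] W'(3)[of x x' x] W'(3)[of y y' y] sub that by blast
    qed
    ultimately show "\<exists>W. P W \<and> (\<exists>a. Q j V W a)" by blast
  qed
  then obtain V a where "\<And>n. P (V n)" "\<And>n. Q n (V n) (V (Suc n)) (a n)"
    by metis
  then have "branching_sequence V a C"
    using C(1) by unfold_locales (simp_all add: P_def Q_def K_def, blast)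
  then show ?thesis by blast
qed

section \<open>The subgroup \<open>N\<close> and the tree of subset sums\<close>

context branching_sequence
begin

lemma V_Suc_subset: "V (Suc n) \<subseteq> V n"
proof
  fix x assume "x \<in> V (Suc n)"
  from V_diff[OF this V_zero] show "x \<in> V n" by simp
qed

lemma V_antimono: "m \<le> n \<Longrightarrow> V n \<subseteq> V m"
  by (rule lift_Suc_antimono_le[of V, OF V_Suc_subset])

text \<open>This need not be trivial, as the \<open>V n\<close> need not form a neighbourhood base
  at 0; the avoidance arguments therefore work modulo \<open>N\<close>.\<close>

definition N :: "'a set" where "N = (\<Inter>n. V n)"

lemma N_zero: "0 \<in> N"
  using V_zero by (simp add: N_def)

lemma N_diff: "x \<in> N \<Longrightarrow> y \<in> N \<Longrightarrow> x - y \<in> N"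
  unfolding N_def using V_diff by blast

lemma subspace_N: "intmod.subspace N"
proof -
  have "- x \<in> N" if "x \<in> N" for x
    using N_diff[OF N_zero that] by simp
  moreover from this have "x + y \<in> N" if "x \<in> N" "y \<in> N" for x y
    using N_diff[of x "- y"] that by simp
  ultimately show ?thesis
    unfolding subspace_iff_add_subgroup add_subgroup_def using N_zero by blast
qed

text \<open>Some late \<open>x i\<close> lies in \<open>V (Suc n)\<close> and differs from the
  cluster point \<open>y\<close> by an element of \<open>V (Suc n)\<close>; \<open>V_diff\<close>
  then puts \<open>y\<close> in \<open>V n\<close>.\<close>

lemma accumulation_in_N:
  assumes "\<And>i. x i \<in> V i"
  shows "\<exists>y\<in>N. \<forall>U m. open U \<and> y \<in> U \<longrightarrow> (\<exists>i\<ge>m. x i \<in> U)"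
proof -
  have "x i \<in> C" for i using assms V_sub by blast
  then obtain y where y: "\<And>U m. open U \<Longrightarrow> y \<in> U \<Longrightarrow> \<exists>i\<ge>m. x i \<in> U"
    using compact_accumulation[OF compact, of x] by blast
  have "y \<in> V n" for n
  proof -
    have "((\<lambda>z. z - y) \<longlongrightarrow> y - y) (nhds y)"
      by (intro tendsto_intros filterlim_ident)
    then have "eventually (\<lambda>z. z - y \<in> V (Suc n)) (nhds y)"
      using V_open V_zero by (auto dest: topological_tendstoD)
    then obtain i where "i \<ge> Suc n" "x i - y \<in> V (Suc n)"
      unfolding eventually_nhds using y by blast
    moreover have "x i \<in> V (Suc n)"
      using assms V_antimono[OF \<open>i \<ge> Suc n\<close>] by blast
    ultimately show ?thesis using V_diff[of "x i" n "x i - y"] by simp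
  qed
  with y show ?thesis by (auto simp: N_def)
qed

lemma partial_sum_in_V:
  assumes "m \<le> n" "v \<in> V n"
  shows "(\<Sum>i | i \<in> {m..<n} \<and> i \<in> A. a i) + v \<in> V m"
  using assms
proof (induction n arbitrary: v rule: dec_induct)
  case base
  then show ?case by simp
next
  case (step n)
  show ?case
  proof (cases "n \<in> A")
    case True
    then have "{i. i \<in> {m..<Suc n} \<and> i \<in> A} = insert n {i. i \<in> {m..<n} \<and> i \<in> A}"
      using step.hyps by auto
    then show ?thesis
      \<comment> \<open>The last summand is absorbed into the remainder: the induction hypothesis is
        used with \<open>a n + v\<close> in place of \<open>v\<close>.\<close>
      using step.IH[OF V_shift[OF step.prems]] by (simp add: algebra_simps)
  next
    case False
    then have "{i. i \<in> {m..<Suc n} \<and> i \<in> A} = {i. i \<in> {m..<n} \<and> i \<in> A}"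
      by (auto simp: less_Suc_eq)
    then show ?thesis
      using step.IH[of v] step.prems V_Suc_subset by auto
  qed
qed

text \<open>The witness is an accumulation point of the partial sums, as the full series need not converge.\<close>

lemma subset_sum_exists:
  "\<exists>x. \<forall>n\<ge>m. \<exists>v\<in>V n. \<exists>v'\<in>V n. x = (\<Sum>i | i \<in> {m..<n} \<and> i \<in> A. a i) + (v - v')"
proof -
  define s where "s n = (\<Sum>i | i \<in> {m..<n} \<and> i \<in> A. a i)" for n
  have "s n \<in> V m" for n
    using partial_sum_in_V[of m n 0 A] V_zero by (cases "m \<le> n") (auto simp: s_def)
  then have "s n \<in> C" for n using V_sub by blast
  then obtain x where x: "\<And>U l. open U \<Longrightarrow> x \<in> U \<Longrightarrow> \<exists>n\<ge>l. s n \<in> U"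
    using compact_accumulation[OF compact, of s] by blast
  have "\<exists>v\<in>V n. \<exists>v'\<in>V n. x = s n + (v - v')" if "n \<ge> m" for n
  proof -
    have "((\<lambda>z. z - x) \<longlongrightarrow> x - x) (nhds x)"
      by (intro tendsto_intros filterlim_ident)
    then have "eventually (\<lambda>z. z - x \<in> V n) (nhds x)"
      using V_open V_zero by (auto dest: topological_tendstoD)
    then obtain l where l: "l \<ge> n" "s l - x \<in> V n"
      unfolding eventually_nhds using x by blast
    let ?v = "\<Sum>i | i \<in> {n..<l} \<and> i \<in> A. a i"
    have split: "{i. i \<in> {m..<l} \<and> i \<in> A} = {i. i \<in> {m..<n} \<and> i \<in> A} \<union> {i. i \<in> {n..<l} \<and> i \<in> A}"
      using l that by auto
    have "s l = s n + ?v"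
      unfolding s_def split by (rule sum.union_disjoint) auto
    \<comment> \<open>The tail from \<open>n\<close> to \<open>l\<close> lies in \<open>V n\<close>
      however large \<open>l\<close> is, so the error at stage \<open>n\<close> is a difference of
      two elements of \<open>V n\<close>.\<close>
    then have "x = s n + (?v - (s l - x))"
      by simp
    moreover have "?v \<in> V n"
      using partial_sum_in_V[OF l(1), of 0 A] V_zero by simp
    ultimately show ?thesis using l(2) by blast
  qed
  then show ?thesis unfolding s_def by blast
qed

text \<open>Stands for "\<open>x\<close> is the sum of the \<open>a i\<close> over \<open>i\<close>
  in \<open>A\<close> from \<open>m\<close> on" without assuming convergence; \<open>A\<close> fixes
  \<open>x\<close> only modulo \<open>N\<close>.\<close>

definition branch :: "nat \<Rightarrow> nat set \<Rightarrow> 'a \<Rightarrow> bool" where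
  "branch m A x \<longleftrightarrow>
    (\<forall>n\<ge>m. \<exists>v\<in>V n. \<exists>v'\<in>V n. x = (\<Sum>i | i \<in> {m..<n} \<and> i \<in> A. a i) + (v - v'))"

text \<open>At stage \<open>Suc m\<close> the partial sum is empty, leaving only a difference of two
  elements of \<open>V (Suc m)\<close>.\<close>

lemma branch_in_V:
  assumes "branch (Suc m) A x"
  shows "x \<in> V m"
proof -
  obtain v v' where "v \<in> V (Suc m)" "v' \<in> V (Suc m)"
      "x = (\<Sum>i | i \<in> {Suc m..<Suc m} \<and> i \<in> A. a i) + (v - v')"
    using assms unfolding branch_def by blast
  then show ?thesis using V_diff by simp
qed

text \<open>The summands below \<open>n\<close> cancel, so \<open>x - y\<close> is
  \<open>a n\<close> up to the errors that \<open>separated\<close> tolerates.\<close>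

lemma branch_separated:
  assumes "branch m A x" "branch m B y" "m \<le> n"
    and agree: "\<And>i. m \<le> i \<Longrightarrow> i < n \<Longrightarrow> i \<in> A \<longleftrightarrow> i \<in> B"
    and n: "n \<in> A" "n \<notin> B"
    and k: "\<bar>k\<bar> \<le> int n" "int_multiple k (g :: 'a) \<noteq> 0"
  shows "int_multiple k (x - y) \<notin> N"
proof -
  have sets: "{i. i \<in> {m..<Suc n} \<and> i \<in> A} = insert n {i. i \<in> {m..<n} \<and> i \<in> A}"
    "{i. i \<in> {m..<Suc n} \<and> i \<in> B} = {i. i \<in> {m..<n} \<and> i \<in> A}"
    using agree n assms(3) by (auto simp: less_Suc_eq)
  obtain v v' where v: "v \<in> V (Suc n)" "v' \<in> V (Suc n)"
      "x = (\<Sum>i | i \<in> {m..<Suc n} \<and> i \<in> A. a i) + (v - v')"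
    using assms(1,3) unfolding branch_def by (meson le_SucI)
  obtain w w' where w: "w \<in> V (Suc n)" "w' \<in> V (Suc n)"
      "y = (\<Sum>i | i \<in> {m..<Suc n} \<and> i \<in> B. a i) + (w - w')"
    using assms(2,3) unfolding branch_def by (meson le_SucI)
  have "x - y = a n + (v - v') - (w - w')"
    unfolding v(3) w(3) sets by simp
  then have "int_multiple k (x - y) \<notin> V (Suc n)"
    using separated[OF k, of v v' w w'] v(1,2) w(1,2) by simp
  then show ?thesis by (auto simp: N_def)
qed

text \<open>
  For fixed \<open>k\<close> and \<open>t\<close>, two branches with \<open>k x \<in> t + N\<close> already differ below \<open>\<bar>k\<bar>\<close>,
  so each pair \<open>(k, t)\<close> excludes only finitely many branches.
\<close>

lemma avoiding_element_exists:
  assumes T: "T \<prec> (UNIV :: real set)"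
  shows "\<exists>x\<in>V m. \<forall>k. (\<exists>g::'a. int_multiple k g \<noteq> 0) \<longrightarrow> (\<forall>t\<in>T. int_multiple k x - t \<notin> N)"
proof (rule ccontr)
  assume neg: "\<not> ?thesis"
  \<comment> \<open>Shifting by \<open>Suc m\<close> lets every set of naturals label a branch that
    starts at \<open>Suc m\<close> and so has its value in \<open>V m\<close>.\<close>
  have "\<exists>x. branch (Suc m) ((+) (Suc m) ` \<alpha>) x" for \<alpha>
    unfolding branch_def by (rule subset_sum_exists)
  then obtain X where X: "\<And>\<alpha>. branch (Suc m) ((+) (Suc m) ` \<alpha>) (X \<alpha>)"
    by metis
  have "\<exists>k t. (\<exists>g::'a. int_multiple k g \<noteq> 0) \<and> t \<in> T \<and> int_multiple k (X \<alpha>) - t \<in> N" for \<alpha>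
    using neg branch_in_V[OF X] by blast
  then obtain k t where kt: "\<And>\<alpha>. \<exists>g::'a. int_multiple (k \<alpha>) g \<noteq> 0" "\<And>\<alpha>. t \<alpha> \<in> T"
      "\<And>\<alpha>. int_multiple (k \<alpha>) (X \<alpha>) - t \<alpha> \<in> N"
    by metis
  \<comment> \<open>Records the pair that excludes the branch and the branch below
    \<open>\<bar>k\<bar>\<close>. Equal codes force the first disagreement to
    \<open>\<bar>k\<bar>\<close> or beyond, where \<open>branch_separated\<close> applies.\<close>
  define c where "c \<alpha> = (t \<alpha>, k \<alpha>, map (\<lambda>i. i \<in> \<alpha>) [0..<nat \<bar>k \<alpha>\<bar>])" for \<alpha>
  have "\<alpha> = \<beta>" if c: "c \<alpha> = c \<beta>" for \<alpha> \<beta>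
  proof (rule ccontr)
    assume "\<alpha> \<noteq> \<beta>"
    then have ex: "\<exists>i. (i \<in> \<alpha>) \<noteq> (i \<in> \<beta>)" by blast
    define j where "j = (LEAST i. (i \<in> \<alpha>) \<noteq> (i \<in> \<beta>))"
    have j: "(j \<in> \<alpha>) \<noteq> (j \<in> \<beta>)"
      unfolding j_def by (rule LeastI_ex[OF ex])
    have below: "i \<in> \<alpha> \<longleftrightarrow> i \<in> \<beta>" if "i < j" for i
      using not_less_Least that unfolding j_def by blast
    have eq: "k \<beta> = k \<alpha>" "t \<beta> = t \<alpha>" "i < nat \<bar>k \<alpha>\<bar> \<Longrightarrow> i \<in> \<alpha> \<longleftrightarrow> i \<in> \<beta>" for i
      using c by (auto simp: c_def)
    have "nat \<bar>k \<alpha>\<bar> \<le> j"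
      using j eq(3) by (meson not_le)
    then have kj: "\<bar>k \<alpha>\<bar> \<le> int (Suc m + j)"
      by linarith
    obtain g :: 'a where g: "int_multiple (k \<alpha>) g \<noteq> 0"
      using kt(1) by blast
    have "(int_multiple (k \<alpha>) (X \<alpha>) - t \<alpha>) - (int_multiple (k \<alpha>) (X \<beta>) - t \<alpha>) \<in> N"
      using N_diff kt(3)[of \<alpha>] kt(3)[of \<beta>] eq by metis
    then have d1: "int_multiple (k \<alpha>) (X \<alpha> - X \<beta>) \<in> N"
      by (simp add: intmod.scale_right_diff_distrib)
    \<comment> \<open>Both signs are kept since the first disagreement may belong to either set,
      whereas \<open>branch_separated\<close> wants it in the first.\<close>
    then have d2: "int_multiple (k \<alpha>) (X \<beta> - X \<alpha>) \<in> N"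
      using N_diff[OF N_zero d1] by (simp add: intmod.scale_right_diff_distrib)
    have agree: "i \<in> (+) (Suc m) ` \<alpha> \<longleftrightarrow> i \<in> (+) (Suc m) ` \<beta>" if "Suc m \<le> i" "i < Suc m + j" for i
    proof -
      have "i = Suc m + (i - Suc m)" "i - Suc m < j" using that by auto
      then show ?thesis using below[of "i - Suc m"] by (metis (no_types, lifting) add_left_cancel image_iff)
    qed
    have mem: "Suc m + j \<in> (+) (Suc m) ` \<gamma> \<longleftrightarrow> j \<in> \<gamma>" for \<gamma>
      by auto
    show False
    proof (cases "j \<in> \<alpha>")
      case True
      then show False
        using branch_separated[OF X[of \<alpha>] X[of \<beta>] le_add1[of "Suc m" j] agree _ _ kj g] d1 j mem by blast
    next
      case False
      then show False
        using branch_separated[OF X[of \<beta>] X[of \<alpha>] le_add1[of "Suc m" j] agree[symmetric] _ _ kj g] d2 j mem by blast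
    qed
  qed
  then have "inj c" by (rule injI)
  then have "(UNIV :: nat set set) \<lesssim> T \<times> (UNIV :: (int \<times> bool list) set)"
    unfolding lepoll_def using kt(2) by (intro exI[of _ c]) (auto simp: c_def)
  then have "(UNIV :: real set) \<lesssim> T \<times> (UNIV :: (int \<times> bool list) set)"
    by (rule lepoll_trans[OF UNIV_real_lepoll_nat_set])
  also have "\<dots> \<prec> (UNIV :: real set)"
    using T by (rule lesspoll_real_times_countable) simp
  finally show False by simp
qed

section \<open>The dense subgroup avoiding \<open>S\<close>\<close>

lemma independent_dense_subgroup:
  assumes S: "add_subgroup S" "S \<prec> (UNIV :: real set)"
    and E: "countable E" "closure E = (UNIV :: 'a set)"
  shows "\<exists>D. add_subgroup D \<and> countable D \<and> closure D = (UNIV :: 'a set) \<and> S \<inter> D = {0}"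
proof -
  have "E \<noteq> {}" using E(2) by auto
  then obtain d :: "nat \<Rightarrow> 'a" where d: "range d = E"
    using E(1) by (metis range_from_nat_into)
  define H where "H x i = intmod.span (E \<union> x ` {..<i})" for x :: "nat \<Rightarrow> 'a" and i :: nat
  have "\<exists>x. \<forall>i. x i \<in> V i \<and> (\<forall>k. (\<exists>g::'a. int_multiple k g \<noteq> 0) \<longrightarrow>
      (\<forall>s\<in>S. \<forall>e\<in>H x i. int_multiple k (x i) - (s + e) \<notin> N))"
  \<comment> \<open>Recursive choice is possible because \<open>H x i\<close> depends only on the
    values of \<open>x\<close> below \<open>i\<close>.\<close>
  proof (rule dependent_wellorder_choice)
    fix r and f g :: "nat \<Rightarrow> 'a" and i :: nat
    assume "\<And>j. j < i \<Longrightarrow> f j = g j"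
    then have "H f i = H g i" unfolding H_def by (metis image_cong lessThan_iff)
    then show "(r \<in> V i \<and> (\<forall>k. (\<exists>g::'a. int_multiple k g \<noteq> 0) \<longrightarrow>
        (\<forall>s\<in>S. \<forall>e\<in>H f i. int_multiple k r - (s + e) \<notin> N))) =
      (r \<in> V i \<and> (\<forall>k. (\<exists>g::'a. int_multiple k g \<noteq> 0) \<longrightarrow>
        (\<forall>s\<in>S. \<forall>e\<in>H g i. int_multiple k r - (s + e) \<notin> N)))"
      by simp
  next
    fix i and f :: "nat \<Rightarrow> 'a"
    have "countable (H f i)"
      unfolding H_def using E by (intro countable_span) simp
    then have "S \<times> H f i \<prec> (UNIV :: real set)"
      using S lesspoll_real_times_countable by blast
    then have "(\<lambda>(s, e). s + e) ` (S \<times> H f i) \<prec> (UNIV :: real set)"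
      using image_lepoll lesspoll_trans1 by blast
    from avoiding_element_exists[OF this, of i]
    show "\<exists>r. r \<in> V i \<and> (\<forall>k. (\<exists>g::'a. int_multiple k g \<noteq> 0) \<longrightarrow>
        (\<forall>s\<in>S. \<forall>e\<in>H f i. int_multiple k r - (s + e) \<notin> N))"
      by auto
  qed
  then obtain x where x: "\<And>i. x i \<in> V i"
      "\<And>i k g s e. int_multiple k (g :: 'a) \<noteq> 0 \<Longrightarrow> s \<in> S \<Longrightarrow> e \<in> H x i \<Longrightarrow>
        int_multiple k (x i) - (s + e) \<notin> N"
    by blast
  \<comment> \<open>The pairing function splits the indices into infinitely many subsequences; since
    \<open>i\<close> is at most \<open>prod_encode (j, i)\<close>, each satisfies the hypothesis of
    \<open>accumulation_in_N\<close>.\<close>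
  have "\<exists>y\<in>N. \<forall>U m. open U \<and> y \<in> U \<longrightarrow> (\<exists>i\<ge>m. x (prod_encode (j, i)) \<in> U)" for j
  proof (rule accumulation_in_N)
    show "x (prod_encode (j, i)) \<in> V i" for i
      using x(1) V_antimono[OF le_prod_encode_2] by blast
  qed
  then obtain y where y: "\<And>j. y j \<in> N"
      "\<And>j U. open U \<Longrightarrow> y j \<in> U \<Longrightarrow> \<exists>i. x (prod_encode (j, i)) \<in> U"
    by metis
  \<comment> \<open>Along the \<open>j\<close>-th subsequence \<open>x i\<close> accumulates at
    \<open>y j\<close>, hence \<open>u i\<close> at \<open>d j\<close>.\<close>
  define u where "u i = (let j = fst (prod_decode i) in d j - y j + x i)" for i
  define D where "D = intmod.span (range u)"
  have D: "intmod.subspace D" by (simp add: D_def)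
  have "countable D" unfolding D_def by (intro countable_span) simp
  have dj: "d j \<in> closure D" for j
    unfolding closure_iff_nhds_not_empty
  proof (intro allI impI)
    fix A U assume "U \<subseteq> A" "open U" "d j \<in> U"
    have "((\<lambda>z. d j - y j + z) \<longlongrightarrow> d j - y j + y j) (nhds (y j))"
      by (intro tendsto_intros filterlim_ident)
    then have "eventually (\<lambda>z. d j - y j + z \<in> U) (nhds (y j))"
      using \<open>open U\<close> \<open>d j \<in> U\<close> by (auto dest: topological_tendstoD)
    then obtain i where "d j - y j + x (prod_encode (j, i)) \<in> U"
      unfolding eventually_nhds using y(2) by blast
    then have "u (prod_encode (j, i)) \<in> U" by (simp add: u_def)
    moreover have "u (prod_encode (j, i)) \<in> D"
      unfolding D_def by (intro intmod.span_base) simp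
    ultimately show "D \<inter> A \<noteq> {}" using \<open>U \<subseteq> A\<close> by blast
  qed
  then have "E \<subseteq> closure D" using d by blast
  then have "closure D = UNIV"
    using closure_minimal[of E "closure D"] E(2) by auto
  \<comment> \<open>Initial segments of the generators, so that the last generator can be removed by
    induction.\<close>
  define L where "L n = intmod.span (u ` {..<n})" for n
  have L_sub: "\<exists>e\<in>H x n. \<exists>v\<in>N. w = e + v" if "w \<in> L n" for w n
  proof -
    have "L n \<subseteq> {e + v |e v. e \<in> H x n \<and> v \<in> N}"
      unfolding L_def
    proof (rule intmod.span_minimal)
      show "u ` {..<n} \<subseteq> {e + v |e v. e \<in> H x n \<and> v \<in> N}"
      proof clarify
        fix i assume "i < n"
        let ?j = "fst (prod_decode i)"
        have "d ?j + x i \<in> H x n"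
          unfolding H_def using \<open>i < n\<close> d by (intro intmod.span_add intmod.span_base) auto
        moreover have "- y ?j \<in> N" using y(1) subspace_N intmod.subspace_neg by blast
        moreover have "u i = (d ?j + x i) + - y ?j" by (simp add: u_def Let_def)
        ultimately show "\<exists>e v. u i = e + v \<and> e \<in> H x n \<and> v \<in> N" by blast
      qed
      show "intmod.subspace {e + v |e v. e \<in> H x n \<and> v \<in> N}"
        by (rule intmod_subspace_sums) (simp_all add: H_def subspace_N)
    qed
    then show ?thesis using that by blast
  qed
  have S_sub: "intmod.subspace S" using S(1) by (simp add: subspace_iff_add_subgroup)
  have L_zero: "w = 0" if "w \<in> L n" "w \<in> S" for w n
    using that
  proof (induction n arbitrary: w)
    case 0
    then show ?case by (simp add: L_def)
  next
    case (Suc n)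
    obtain k where k: "w - int_multiple k (u n) \<in> L n"
      using Suc.prems(1) unfolding L_def lessThan_Suc image_insert intmod.span_insert by blast
    \<comment> \<open>The choice of \<open>x n\<close> rules out every \<open>k\<close> that does
      not annihilate the whole group; an annihilating \<open>k\<close> makes the last term
      vanish.\<close>
    have "int_multiple k g = 0" for g :: 'a
    proof (rule ccontr)
      assume g: "int_multiple k g \<noteq> 0"
      obtain e v where ev: "e \<in> H x n" "v \<in> N" "w - int_multiple k (u n) = e + v"
        using L_sub[OF k] by blast
      let ?j = "fst (prod_decode n)"
      \<comment> \<open>Solving for the multiple of \<open>x n\<close>: what remains besides
        \<open>w\<close> and an element of \<open>H x n\<close> consists of terms from
        \<open>N\<close>.\<close>
      have "int_multiple k (x n) - (w + (- e - int_multiple k (d ?j))) = int_multiple k (y ?j) - v"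
        using ev(3) by (simp add: u_def Let_def intmod.scale_right_distrib
            intmod.scale_right_diff_distrib algebra_simps)
      also have "\<dots> \<in> N"
        using y(1) ev(2) subspace_N intmod.subspace_scale N_diff by blast
      finally have "int_multiple k (x n) - (w + (- e - int_multiple k (d ?j))) \<in> N" .
      moreover have "- e - int_multiple k (d ?j) \<in> H x n"
        using ev(1) d unfolding H_def
        by (intro intmod.span_diff[OF intmod.span_neg] intmod.span_scale intmod.span_base[of "d _"]) auto
      ultimately show False using x(2)[OF g Suc.prems(2)] by blast
    qed
    then have "w \<in> L n" using k by simp
    then show ?case using Suc by blast
  qed
  have "w = 0" if w: "w \<in> S" "w \<in> D" for w
  proof -
    obtain t r where t: "finite t" "t \<subseteq> range u" "w = (\<Sum>b\<in>t. int_multiple (r b) b)"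
      using w(2) unfolding D_def intmod.span_explicit by blast
    then obtain I where I: "finite I" "t = u ` I"
      using finite_subset_image[of t u UNIV] by blast
    obtain n where "I \<subseteq> {..<n}" using finite_nat_bounded[OF I(1)] by blast
    then have "w \<in> L n" unfolding L_def t(3) I(2)
      by (intro intmod.span_sum intmod.span_scale intmod.span_base) blast
    then show ?thesis using w L_zero by blast
  qed
  then have "S \<inter> D = {0}"
    using S_sub D intmod.subspace_0 by blast
  then show ?thesis
    using D \<open>countable D\<close> \<open>closure D = UNIV\<close> subspace_iff_add_subgroup by blast
qed

end

section \<open>The two implications\<close>

text \<open>Supplies the uncountability hypothesis of \<open>branching_sequence_exists\<close>: the
  range contains 0 and a nonzero element, which excludes cardinality 1.\<close>

lemma M_group_uncountable_range:
  assumes "M_group TYPE('a::ab_group_add)" "int_multiple n (g :: 'a) \<noteq> 0"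
  shows "uncountable (range (int_multiple n :: 'a \<Rightarrow> 'a))"
proof
  assume "countable (range (int_multiple n :: 'a \<Rightarrow> 'a))"
  then have "\<not> (UNIV :: real set) \<lesssim> range (int_multiple n :: 'a \<Rightarrow> 'a)"
    using countable_lepoll uncountable_UNIV_real by blast
  then have "card (range (int_multiple n :: 'a \<Rightarrow> 'a)) = 1"
    using assms(1) unfolding M_group_def by blast
  then obtain b where "range (int_multiple n :: 'a \<Rightarrow> 'a) = {b}"
    by (auto simp: card_1_singleton_iff)
  then show False
    using assms(2) intmod.scale_zero_right by (metis rangeI singletonD)
qed

lemma d_independent_imp_M_group:
  assumes "d_independent TYPE('a::{topological_ab_group_add, t2_space})"
  shows "M_group TYPE('a)"
  unfolding M_group_def
proof (intro allI)
  fix n :: int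
  let ?R = "range (int_multiple n :: 'a \<Rightarrow> 'a)"
  have "card ?R = 1" if small: "?R \<prec> (UNIV :: real set)"
  proof -
    have "add_subgroup ?R"
      unfolding add_subgroup_def
    proof (intro conjI ballI)
      show "0 \<in> ?R" by (metis intmod.scale_zero_right rangeI)
      show "x + y \<in> ?R" if "x \<in> ?R" "y \<in> ?R" for x y
        using that by (auto simp flip: intmod.scale_right_distrib)
      show "- x \<in> ?R" if "x \<in> ?R" for x
        using that by (auto simp flip: intmod.scale_minus_right)
    qed
    then obtain D :: "'a set" where D: "add_subgroup D" "closure D = UNIV" "?R \<inter> D = {0}"
      using assms small unfolding d_independent_def by blast
    \<comment> \<open>A multiple of an element of \<open>D\<close> lies in both subgroups, so it is
      0; the kernel is closed and therefore contains the closure of \<open>D\<close>.\<close>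
    have "D \<subseteq> {x. int_multiple n x = 0}"
    proof clarify
      fix x assume "x \<in> D"
      then have "int_multiple n x \<in> ?R \<inter> D"
        using D(1) by (auto simp flip: subspace_iff_add_subgroup intro: intmod.subspace_scale)
      then show "int_multiple n x = 0" using D(3) by blast
    qed
    moreover have "closed {x::'a. int_multiple n x = 0}"
      by (intro closed_Collect_eq continuous_on_int_multiple continuous_on_const)
    ultimately have "closure D \<subseteq> {x. int_multiple n x = 0}"
      by (rule closure_minimal)
    then have "int_multiple n x = 0" for x :: 'a using D(2) by auto
    then have "?R = {0}" by auto
    then show ?thesis by simp
  qed
  then show "card ?R = 1 \<or> (UNIV :: real set) \<lesssim> ?R"
    using lepoll_or_lesspoll by blast
qed

theorem theorem2p6:
  assumes nontrivial: "\<exists>x::'a::{topological_ab_group_add, t2_space}. x \<noteq> 0"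
    and separable: "separable_space (euclidean :: 'a topology)"
    and locally_compact: "locally_compact_space (euclidean :: 'a topology)"
  shows "d_independent TYPE('a) \<longleftrightarrow> M_group TYPE('a)"
proof
  assume "d_independent TYPE('a)"
  then show "M_group TYPE('a)" by (rule d_independent_imp_M_group)
next
  assume M: "M_group TYPE('a)"
  obtain E :: "'a set" where E: "countable E" "closure E = UNIV"
    using separable unfolding separable_space_def by auto
  obtain U C :: "'a set" where "open U" "compact C" "0 \<in> U" "U \<subseteq> C"
    using locally_compact unfolding locally_compact_space_def by (simp; metis)
  then obtain V a where "branching_sequence V a C"
    using branching_sequence_exists[OF E, of C U] M_group_uncountable_range[OF M] by blast
  then show "d_independent TYPE('a)"
    unfolding d_independent_def
    using nontrivial branching_sequence.independent_dense_subgroup E by blast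
qed

end
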